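(* There is an absolute constant $C>0$ such that for all positive integers $n$ (odd) and $t$, the value of the $t$-fold symmetric repetition of the odd cycle game satisfies ${\sf val}(C_n^{\otimes_{\sf sym} t})\geq 1-C\,\frac{t}{n\sqrt{\log t}}$.
   Context: The odd cycle game $C_n$ ($n$ odd) is the following two-prover one-round game. The verifier picks a vertex $u$ of the $n$-cycle $\mathbb{Z}_n$ uniformly at random; with probability $1/2$ sets $v=u$, and otherwise sets $v$ to be one of the two neighbours of $u$, each with equal probability. It sends $u$ to the first prover and $v$ to the second, receives bits $b_1,b_2$, and accepts iff $b_1=b_2$ when $u=v$ and $b_1\neq b_2$ when $u\neq v$. The $t$-fold symmetric repetition $C_n^{\otimes_{\sf sym} t}$: the verifier samples $t$ independent challenges $(u_1,v_1),\dots,(u_t,v_t)$ of $C_n$ and sends them as unordered tuples $\{u_1,\dots,u_t\}$ and $\{v_1,\dots,v_t\}$; each prover answers a bit for each element it received, and the verifier accepts iff every constraint $(u_i,v_i)$ is satisfied by the corresponding answers. Equivalently, a prover strategy is a function $A\colon\mathbb{Z}_n^t\to\{0,1\}^t$ with $A(\pi(x))=\pi(A(x))$ for all permutations $\pi$ of $[t]$. The value ${\sf val}$ is the maximum over prover strategies of the acceptance probability. *)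

theory Defs
  imports "HOL-Probability.Probability" "HOL-Combinatorics.Permutations"
begin

(* The cycle Z_n is represented by the residues {0..<n} in int. *)

definition cycle_vertices :: "nat \<Rightarrow> int set" where
  "cycle_vertices n = {0..<int n}"

(* The sign d chooses between the two neighbours u + 1 and u - 1 of u modulo n. *)

definition odd_cycle_challenge :: "nat \<Rightarrow> (int \<times> int) pmf" where
  "odd_cycle_challenge n =
     do {
       u \<leftarrow> pmf_of_set (cycle_vertices n);
       same \<leftarrow> bernoulli_pmf (1/2);
       if same then return_pmf (u, u)
       else do {
         d \<leftarrow> pmf_of_set {1, -1};
         return_pmf (u, (u + d) mod int n)
       }
     }"

definition odd_cycle_accepts :: "int \<times> int \<Rightarrow> bool \<Rightarrow> bool \<Rightarrow> bool" where
  "odd_cycle_accepts q b1 b2 \<longleftrightarrow> (if fst q = snd q then b1 = b2 else b1 \<noteq> b2)"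

(* Strategies on unordered t-tuples, written as maps on ordered t-tuples that commute with
   all permutations of the t coordinates. In particular, equal entries of a tuple receive
   equal answers. *)

definition sym_strategies :: "'q set \<Rightarrow> nat \<Rightarrow> ('q list \<Rightarrow> bool list) set" where
  "sym_strategies Q t =
     {A. \<forall>x. set x \<subseteq> Q \<and> length x = t \<longrightarrow>
           length (A x) = t \<and>
           (\<forall>\<pi>. \<pi> permutes {..<t} \<longrightarrow> A (permute_list \<pi> x) = permute_list \<pi> (A x))}"

definition sym_odd_cycle_accept_prob ::
    "nat \<Rightarrow> nat \<Rightarrow> (int list \<Rightarrow> bool list) \<Rightarrow> (int list \<Rightarrow> bool list) \<Rightarrow> real" where
  "sym_odd_cycle_accept_prob n t A B =
     measure_pmf.prob (replicate_pmf t (odd_cycle_challenge n))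
       {qs. \<forall>i<t. odd_cycle_accepts (qs ! i) (A (map fst qs) ! i) (B (map snd qs) ! i)}"

(* The two provers may use different strategies. The supremum is a maximum: the acceptance
   probability depends only on the values of A and B on the finite set of t-tuples of
   vertices (for n > 0). *)

definition sym_odd_cycle_value :: "nat \<Rightarrow> nat \<Rightarrow> real" where
  "sym_odd_cycle_value n t =
     (SUP (A, B) \<in> sym_strategies (cycle_vertices n) t \<times> sym_strategies (cycle_vertices n) t.
        sym_odd_cycle_accept_prob n t A B)"

end

(* Cutting the cycle at a vertex p turns it into a path, and the bits "parity of the distance
   from p" only violate a constraint that crosses the cut. So it suffices to choose, symmetrically
   in the received points, a cut that is stable under the noise (u_i) -> (v_i) and that no point
   crosses. Give the cut p the weight N_p(x) = \<Prod>_i dip(x_i - p)^2, where dip = min(R, distance to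
   the cut) and R is of order n log t / t: a smoothed density of uniform points conditioned to
   avoid a gap of width about R around p.

   N_p is the square of a product, so a Hellinger estimate bounds E|N_p(x) - N_p(v)| / E N_p by
   O(sqrt(t / (n R))) = O(t / (n sqrt(log t))); the steps of the individual points add up in square
   rather than linearly, which is where the gain over t / n comes from. For R = c n log t / t with
   small c, a planted gap changes the uniform distribution so little that the average of N_p over p
   concentrates, with relative variance O(log t / sqrt t). Where it falls below half its mean, the
   weights are topped up uniformly; there the t / n loss is harmless because the event is rare.

   Correlated sampling turns the weights into deterministic strategies. *)

theory Submission
  imports Defs
begin

section \<open>Correlated sampling by derandomized rejection\<close>

lemma sum_of_bool_less:
  fixes q M :: nat
  assumes "q \<le> M"
  shows "(\<Sum>\<theta><M. of_bool (\<theta> < q)) = real q"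
proof -
  have "{\<theta>. \<theta> < M \<and> \<theta> < q} = {..<q}" using assms by auto
  then show ?thesis by (simp add: of_bool_def sum.If_cases Int_def)
qed

text \<open>Measures the thresholds on which two acceptance tests disagree: they fill the interval
  from \<open>min q q'\<close> to \<open>max q q'\<close>.\<close>

lemma sum_of_bool_less_neq:
  fixes q q' M :: nat
  assumes "q \<le> M" "q' \<le> M"
  shows "(\<Sum>\<theta><M. of_bool ((\<theta> < q) \<noteq> (\<theta> < q'))) = \<bar>real q - real q'\<bar>"
proof -
  have "(\<Sum>\<theta><M. of_bool ((\<theta> < q) \<noteq> (\<theta> < q'))) 
     = (\<Sum>\<theta><M. of_bool (\<theta> < max q q') - (of_bool (\<theta> < min q q') :: real))"
    by (intro sum.cong) (auto simp: of_bool_def max_def min_def)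
  also have "\<dots> = real (max q q') - real (min q q')"
    using assms unfolding sum_subtractf by (subst (1 2) sum_of_bool_less) auto
  finally show ?thesis by auto
qed

lemma exists_le_average:
  fixes f :: "'a \<Rightarrow> real"
  assumes "finite A" "A \<noteq> {}" "sum f A \<le> real (card A) * B"
  shows "\<exists>x\<in>A. f x \<le> B"
proof (rule ccontr)
  assume "\<not> ?thesis"
  then have "(\<Sum>x\<in>A. B) < sum f A" using assms by (intro sum_strict_mono) auto
  with assms show False by simp
qed

text \<open>Rejection sampling: draw uniform pairs \<open>(p, \<theta>)\<close> and let \<open>x\<close> accept the first one with \<open>\<theta> < q x p\<close>.
  Each round is derandomized by averaging, so \<open>K\<close> rounds give a deterministic \<open>c\<close>; the power bounds
  the probability that \<open>K\<close> rounds pass without acceptance. As \<open>c\<close> is a function of \<open>x\<close>, it is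
  symmetric as soon as \<open>x\<close> is a multiset.\<close>

lemma correlated_choice:
  fixes w :: "'e \<Rightarrow> real" and a b :: "'e \<Rightarrow> 'x" and q :: "'x \<Rightarrow> 'p \<Rightarrow> nat"
    and bad :: "'e \<Rightarrow> 'p \<Rightarrow> bool" and P :: "'p set" and h :: real
  defines "D \<equiv> \<lambda>e. (\<Sum>p\<in>P. \<bar>real (q (a e) p) - real (q (b e) p)\<bar> + real (q (a e) p) * of_bool (bad e p)) / h"
  assumes fin: "finite E" "finite P" "P \<noteq> {}" and M: "M > 0" and h: "h > 0"
    and lower: "\<And>e. e \<in> E \<Longrightarrow> h \<le> (\<Sum>p\<in>P. real (q (a e) p))"
    and upper: "\<And>e p. e \<in> E \<Longrightarrow> p \<in> P \<Longrightarrow> q (a e) p \<le> M"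
      "\<And>e p. e \<in> E \<Longrightarrow> p \<in> P \<Longrightarrow> q (b e) p \<le> M"
    and w: "\<And>e. e \<in> E \<Longrightarrow> w e \<ge> 0"
  shows "\<exists>c. (\<forall>x. c x \<in> P) \<and>
    (\<Sum>e\<in>E. w e * of_bool (c (a e) \<noteq> c (b e) \<or> bad e (c (a e))))
      \<le> (\<Sum>e\<in>E. w e * (D e + (1 - h / (real (card P) * real M)) ^ K))"
  using w
proof (induction K arbitrary: w)
  case 0
  \<comment> \<open>With no round left the default is an arbitrary \<open>p\<close>; the claimed
    bound is at least 1 per unit of weight, because the zeroth power is 1 and
    \<open>D e \<ge> 0\<close>.\<close>
  obtain p where "p \<in> P" using fin by auto
  have "D e \<ge> 0" for e unfolding D_def using h by (intro divide_nonneg_pos sum_nonneg) auto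
  then show ?case using 0 \<open>p \<in> P\<close>
    by (intro exI[of _ "\<lambda>_. p"]) (auto intro!: sum_mono mult_left_mono simp: of_bool_def)
next
  case (Suc K)
  define r where "r = 1 - h / (real (card P) * real M)"
  define \<Omega> where "\<Omega> = P \<times> {..<M}"
  define k where "k e = D e + r ^ K" for e
  have cardP: "real (card P) > 0" using fin by (simp add: card_gt_0_iff)
  have fin_\<Omega>: "finite \<Omega>" "\<Omega> \<noteq> {}" and card_\<Omega>: "real (card \<Omega>) = real (card P) * real M"
    using fin M by (auto simp: \<Omega>_def)
  \<comment> \<open>Cost charged to \<open>e\<close> for one draw: accepting a bad \<open>p\<close>,
    a disagreement between the two sides, or, if \<open>a e\<close> rejects, the bound
    \<open>k e\<close> for the remaining rounds.\<close>
  define g where "g e p \<theta> = of_bool (\<theta> < q (a e) p) * of_bool (bad e p)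
      + of_bool ((\<theta> < q (a e) p) \<noteq> (\<theta> < q (b e) p)) + (1 - of_bool (\<theta> < q (a e) p)) * k e"
    for e p \<theta>
  have D0: "D e \<ge> 0" for e unfolding D_def using h by (intro divide_nonneg_pos sum_nonneg) auto
  have g_sum: "(\<Sum>\<omega>\<in>\<Omega>. g e (fst \<omega>) (snd \<omega>)) \<le> real (card \<Omega>) * (D e + r ^ Suc K)" if e: "e \<in> E" for e
  proof -
    have "h \<le> (\<Sum>p\<in>P. real (q (a e) p))" using lower e by auto
    also have "\<dots> \<le> (\<Sum>p\<in>P. real M)" using upper e by (intro sum_mono) auto
    finally have "h \<le> real (card P) * real M" by simp
    then have "r \<ge> 0" using cardP M by (simp add: r_def field_simps)
    then have k0: "k e \<ge> 0" using D0 by (simp add: k_def)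
    have "(\<Sum>\<omega>\<in>\<Omega>. g e (fst \<omega>) (snd \<omega>)) = (\<Sum>p\<in>P. \<Sum>\<theta><M. g e p \<theta>)"
      unfolding \<Omega>_def by (simp add: sum.cartesian_product case_prod_unfold)
    also have "\<dots> = (\<Sum>p\<in>P. real (q (a e) p) * of_bool (bad e p)
        + \<bar>real (q (a e) p) - real (q (b e) p)\<bar> + (real M - real (q (a e) p)) * k e)"
      unfolding g_def sum.distrib sum_distrib_right[symmetric] sum_subtractf
      using upper e by (intro sum.cong refl arg_cong2[of _ _ _ _ "(+)"] sum_of_bool_less_neq arg_cong2[of _ _ _ _ "(-)"] arg_cong2[of _ _ _ _ "(*)"] sum_of_bool_less | simp)+
    also have "\<dots> = h * D e + (real (card P) * real M - (\<Sum>p\<in>P. real (q (a e) p))) * k e"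
      using h by (simp add: D_def sum.distrib sum_subtractf left_diff_distrib sum_distrib_right)
    \<comment> \<open>As \<open>k e \<ge> 0\<close>, the accepted mass may be replaced by its lower
      bound \<open>h\<close>. Then \<open>h * D e\<close> and
      \<open>(card \<Omega> - h) * D e\<close> add up to \<open>card \<Omega> * D e\<close>, so
      \<open>D e\<close> does not accumulate over the rounds; only the power of \<open>r\<close>
      changes.\<close>
    also have "\<dots> \<le> h * D e + (real (card P) * real M - h) * k e"
      using lower[OF e] k0 by (intro add_left_mono mult_right_mono) auto
    also have "\<dots> = real (card \<Omega>) * (D e + r ^ Suc K)"
      unfolding card_\<Omega> k_def using cardP M by (simp add: r_def field_simps)
    finally show ?thesis .
  qed
  have "(\<Sum>\<omega>\<in>\<Omega>. \<Sum>e\<in>E. w e * g e (fst \<omega>) (snd \<omega>)) = (\<Sum>e\<in>E. w e * (\<Sum>\<omega>\<in>\<Omega>. g e (fst \<omega>) (snd \<omega>)))"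
    by (subst sum.swap) (simp add: sum_distrib_left)
  also have "\<dots> \<le> (\<Sum>e\<in>E. w e * (real (card \<Omega>) * (D e + r ^ Suc K)))"
    using g_sum Suc.prems by (intro sum_mono mult_left_mono) auto
  also have "\<dots> = real (card \<Omega>) * (\<Sum>e\<in>E. w e * (D e + r ^ Suc K))"
    by (simp only: sum_distrib_left mult.left_commute)
  finally obtain \<omega> where \<omega>: "\<omega> \<in> \<Omega>"
    "(\<Sum>e\<in>E. w e * g e (fst \<omega>) (snd \<omega>)) \<le> (\<Sum>e\<in>E. w e * (D e + r ^ Suc K))"
    using exists_le_average[OF fin_\<Omega>] by blast
  obtain p \<theta> where p: "\<omega> = (p, \<theta>)" "p \<in> P" using \<omega> by (auto simp: \<Omega>_def)
  define hit where "hit x \<longleftrightarrow> \<theta> < q x p" for x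
  \<comment> \<open>Only those \<open>e\<close> whose first side rejects go on to the later rounds.
    This is why the induction runs over arbitrary weights.\<close>
  define w' where "w' e = w e * of_bool (\<not> hit (a e))" for e
  have "\<And>e. e \<in> E \<Longrightarrow> w' e \<ge> 0" using Suc.prems by (simp add: w'_def)
  from Suc.IH[of w', OF this] obtain c where c: "\<And>x. c x \<in> P"
    "(\<Sum>e\<in>E. w' e * of_bool (c (a e) \<noteq> c (b e) \<or> bad e (c (a e)))) \<le> (\<Sum>e\<in>E. w' e * k e)"
    unfolding k_def r_def by blast
  define c' where "c' x = (if hit x then p else c x)" for x
  \<comment> \<open>If both sides hit, both choose \<open>p\<close> and only badness can fail; a hit
    on one side only is charged as a disagreement; if neither hits, \<open>c\<close>
    decides.\<close>
  have "(\<Sum>e\<in>E. w e * of_bool (c' (a e) \<noteq> c' (b e) \<or> bad e (c' (a e))))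
    \<le> (\<Sum>e\<in>E. w e * (of_bool (hit (a e)) * of_bool (bad e p) + of_bool (hit (a e) \<noteq> hit (b e)))
        + w' e * of_bool (c (a e) \<noteq> c (b e) \<or> bad e (c (a e))))"
    using Suc.prems by (intro sum_mono) (auto simp: c'_def w'_def of_bool_def)
  also have "\<dots> \<le> (\<Sum>e\<in>E. w e * (of_bool (hit (a e)) * of_bool (bad e p) + of_bool (hit (a e) \<noteq> hit (b e))))
        + (\<Sum>e\<in>E. w' e * k e)"
    using c(2) by (simp add: sum.distrib)
  also have "\<dots> = (\<Sum>e\<in>E. w e * g e (fst \<omega>) (snd \<omega>))"
    unfolding p(1) sum.distrib[symmetric]
    by (intro sum.cong) (auto simp: g_def w'_def hit_def algebra_simps)
  also have "\<dots> \<le> (\<Sum>e\<in>E. w e * (D e + r ^ Suc K))" by (fact \<omega>(2))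
  finally show ?case using c(1) p(2) unfolding r_def
    by (intro exI[of _ c']) (auto simp: c'_def)
qed

section \<open>Expectations over independent repetitions\<close>

lemma finite_set_replicate_pmf:
  "finite (set_pmf p) \<Longrightarrow> finite (set_pmf (replicate_pmf t p))"
  unfolding set_replicate_pmf using finite_lists_length_eq[of "set_pmf p" t]
  by (auto simp: lists_eq_set elim: rev_finite_subset)

lemma expectation_replicate_pmf_Suc:
  fixes f :: "'a list \<Rightarrow> real"
  assumes "finite (set_pmf p)"
  shows "measure_pmf.expectation (replicate_pmf (Suc t) p) f =
    measure_pmf.expectation p (\<lambda>x. measure_pmf.expectation (replicate_pmf t p) (\<lambda>xs. f (x # xs)))"
proof -
  have "measure_pmf.expectation (replicate_pmf (Suc t) p) f =
    (\<Sum>x\<in>set_pmf p. pmf p x *\<^sub>R measure_pmf.expectation (map_pmf ((#) x) (replicate_pmf t p)) f)"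
    using assms finite_set_replicate_pmf[OF assms]
    by (simp add: pmf_expectation_bind[of "set_pmf p"] map_pmf_def[symmetric])
  then show ?thesis using assms by (simp add: integral_measure_pmf[of "set_pmf p"])
qed

lemma expectation_replicate_pmf_prod_list:
  fixes f :: "'a \<Rightarrow> real"
  assumes "finite (set_pmf p)"
  shows "measure_pmf.expectation (replicate_pmf t p) (\<lambda>xs. prod_list (map f xs)) =
    measure_pmf.expectation p f ^ t"
  by (induction t) (simp_all add: expectation_replicate_pmf_Suc[OF assms] del: replicate_pmf.simps(2))

text \<open>By \<open>indep\<close>, each coordinate satisfies \<open>Q\<close> with probability
  \<open>r\<close> whatever the values of \<open>f\<close> are, and linearity adds up the
  coordinates. The use is with \<open>f = fst\<close> and \<open>Q\<close> saying that the point
  moved.\<close>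

lemma expectation_replicate_pmf_length_filter:
  fixes F :: "'b list \<Rightarrow> real"
  assumes fin: "finite (set_pmf p)"
    and indep: "\<And>h :: 'b \<Rightarrow> real. measure_pmf.expectation p (\<lambda>x. h (f x) * of_bool (Q x)) =
      r * measure_pmf.expectation p (\<lambda>x. h (f x))"
  shows "measure_pmf.expectation (replicate_pmf t p) (\<lambda>xs. F (map f xs) * real (length (filter Q xs))) =
    r * real t * measure_pmf.expectation (replicate_pmf t p) (\<lambda>xs. F (map f xs))"
proof (induction t arbitrary: F)
  case (Suc t)
  let ?E = "measure_pmf.expectation (replicate_pmf t p)"
  have int: "integrable (measure_pmf (replicate_pmf t p)) g" "integrable (measure_pmf p) g'"
    for g :: "'a list \<Rightarrow> real" and g' :: "'a \<Rightarrow> real"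
    using fin finite_set_replicate_pmf[OF fin] by (auto intro: integrable_measure_pmf_finite)
  have "?E (\<lambda>xs. F (f x # map f xs) * real (length (filter Q (x # xs)))) =
     ?E (\<lambda>xs. F (f x # map f xs)) * of_bool (Q x) + r * real t * ?E (\<lambda>xs. F (f x # map f xs))" for x
  proof -
    have "?E (\<lambda>xs. F (f x # map f xs) * real (length (filter Q (x # xs)))) =
      ?E (\<lambda>xs. F (f x # map f xs) * of_bool (Q x) + F (f x # map f xs) * real (length (filter Q xs)))"
      by (intro Bochner_Integration.integral_cong) (auto simp: algebra_simps)
    then show ?thesis using Suc.IH[of "\<lambda>ys. F (f x # ys)"] by (simp add: int)
  qed
  then show ?case
    unfolding expectation_replicate_pmf_Suc[OF fin] list.map
    using indep[of "\<lambda>y. ?E (\<lambda>xs. F (y # map f xs))"]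
    by (simp add: int algebra_simps)
qed simp

section \<open>The cycle and the distribution of a single challenge\<close>

lemma cycle_vertices_finite [simp]: "finite (cycle_vertices n)"
  by (simp add: cycle_vertices_def)

lemma card_cycle_vertices [simp]: "card (cycle_vertices n) = n"
  by (simp add: cycle_vertices_def)

lemma cycle_vertices_nonempty [simp]: "n > 0 \<Longrightarrow> cycle_vertices n \<noteq> {}"
  by (simp add: cycle_vertices_def)

lemma mod_in_cycle_vertices [simp]: "n > 0 \<Longrightarrow> x mod int n \<in> cycle_vertices n"
  by (simp add: cycle_vertices_def)

lemma sum_cycle_shift:
  "(\<Sum>u\<in>cycle_vertices n. f ((u + k) mod int n)) = (\<Sum>u\<in>cycle_vertices n. f u)"
proof (cases "n = 0")
  case False
  then show ?thesis
    by (intro sum.reindex_bij_witness[of _ "\<lambda>u. (u - k) mod int n" "\<lambda>u. (u + k) mod int n"])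
       (auto simp: cycle_vertices_def mod_simps)
qed (simp add: cycle_vertices_def)

lemma set_pmf_odd_cycle_challenge:
  assumes "n > 0"
  shows "set_pmf (odd_cycle_challenge n) =
    {(u, v). u \<in> cycle_vertices n \<and> v \<in> {u, (u + 1) mod int n, (u - 1) mod int n}}"
  using assms by (auto simp: odd_cycle_challenge_def UNIV_bool split: if_splits)

lemma finite_set_pmf_odd_cycle_challenge:
  assumes "n > 0"
  shows "finite (set_pmf (odd_cycle_challenge n))"
proof -
  have "set_pmf (odd_cycle_challenge n) \<subseteq> cycle_vertices n \<times> cycle_vertices n"
    using assms by (auto simp: set_pmf_odd_cycle_challenge)
  then show ?thesis by (rule finite_subset) simp
qed

lemma expectation_odd_cycle_challenge:
  fixes f :: "int \<times> int \<Rightarrow> real"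
  assumes "n > 0"
  shows "measure_pmf.expectation (odd_cycle_challenge n) f =
    (\<Sum>u\<in>cycle_vertices n. f (u, u) / 2 + f (u, (u + 1) mod int n) / 4 + f (u, (u - 1) mod int n) / 4) / real n"
proof -
  define K where "K u = do {
       same \<leftarrow> bernoulli_pmf (1/2);
       if same then return_pmf (u, u)
       else do {
         d \<leftarrow> pmf_of_set {1, -1};
         return_pmf (u, (u + d) mod int n)
       }
     }" for u
  have fin: "finite (set_pmf (K u))" for u
    by (auto simp: K_def split: if_splits)
  have sign: "measure_pmf.expectation (do {
         d \<leftarrow> pmf_of_set {1, -1};
         return_pmf (u, (u + d) mod int n)
       }) f = f (u, (u + 1) mod int n) / 2 + f (u, (u - 1) mod int n) / 2" for u
    by (subst pmf_expectation_bind_pmf_of_set) auto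
  have K: "measure_pmf.expectation (K u) f =
    f (u, u) / 2 + f (u, (u + 1) mod int n) / 4 + f (u, (u - 1) mod int n) / 4" for u
    unfolding K_def
    by (subst pmf_expectation_bind[of UNIV]) (auto simp: sign UNIV_bool)
  have "measure_pmf.expectation (odd_cycle_challenge n) f =
    (\<Sum>u\<in>cycle_vertices n. measure_pmf.expectation (K u) f /\<^sub>R real n)"
    unfolding odd_cycle_challenge_def K_def[symmetric]
    using assms fin by (subst pmf_expectation_bind_pmf_of_set) auto
  then show ?thesis
    by (simp only: K sum_distrib_left real_scaleR_def divide_inverse_commute)
qed

section \<open>The truncated distance to a cut and the weight of a cut\<close>

text \<open>The cut edge joins the residues \<open>n - 1\<close> and \<open>0\<close>; both have \<open>dip\<close> zero.\<close>

definition dip :: "nat \<Rightarrow> nat \<Rightarrow> int \<Rightarrow> nat" where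
  "dip n R u = nat (min (int R) (min u (int n - 1 - u)))"

text \<open>Divided by \<open>n\<close> this is the mean of the squared \<open>dip\<close> at a
  uniform vertex; by rotation the \<open>t\<close>-th power of that mean is the expected weight of
  every cut.\<close>

definition dip_mass :: "nat \<Rightarrow> nat \<Rightarrow> nat" where
  "dip_mass n R = (\<Sum>u\<in>cycle_vertices n. dip n R u ^ 2)"

text \<open>Taking a multiset makes every choice based on these weights symmetric. The factors are
  squares so that their roots, which are Lipschitz in each point, serve as amplitudes.\<close>

definition cut_weight :: "nat \<Rightarrow> nat \<Rightarrow> int \<Rightarrow> int multiset \<Rightarrow> nat" where
  "cut_weight n R p X = (\<Prod>u\<in>#X. dip n R ((u - p) mod int n) ^ 2)"

lemma dip_le: "dip n R u \<le> R"
  by (auto simp: dip_def)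

lemma sum_dip_shift:
  fixes f :: "nat \<Rightarrow> real"
  shows "(\<Sum>u\<in>cycle_vertices n. f (dip n R ((u - p) mod int n))) = (\<Sum>u\<in>cycle_vertices n. f (dip n R u))"
  using sum_cycle_shift[of "\<lambda>u. f (dip n R u)" "- p" n] by simp

lemma dip_mass_ge:
  assumes "2 * R \<le> n"
  shows "real (dip_mass n R) \<ge> real R ^ 2 * (real n - 2 * real R)"
proof -
  have "real R ^ 2 * (real n - 2 * real R) = (\<Sum>u\<in>{int R..<int n - int R}. real R ^ 2)"
    using assms by (simp add: of_nat_diff)
  also have "\<dots> = (\<Sum>u\<in>{int R..<int n - int R}. real (dip n R u) ^ 2)"
    by (intro sum.cong) (auto simp: dip_def)
  also have "\<dots> \<le> (\<Sum>u\<in>cycle_vertices n. real (dip n R u) ^ 2)"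
    by (intro sum_mono2) (auto simp: cycle_vertices_def)
  finally show ?thesis by (simp add: dip_mass_def)
qed

text \<open>\<open>dip\<close> is 1-Lipschitz along the path and constant once it reaches
  \<open>R\<close>, so only \<open>R\<close> steps at each end contribute. The step across the cut
  edge contributes nothing, both its ends having \<open>dip\<close> zero.\<close>

lemma sum_dip_increment:
  assumes "n > 0"
  shows "(\<Sum>u\<in>cycle_vertices n. (real (dip n R ((u + 1) mod int n)) - real (dip n R u))\<^sup>2) \<le> 2 * real R"
proof -
  let ?J = "{0..<int R} \<union> {int n - 1 - int R..<int n - 1}"
  have "(real (dip n R ((u + 1) mod int n)) - real (dip n R u))\<^sup>2 \<le> of_bool (u \<in> ?J)"
    if u: "u \<in> cycle_vertices n" for u
  proof (cases "u = int n - 1")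
    case True
    then show ?thesis by (simp add: dip_def)
  next
    case False
    then have "(u + 1) mod int n = u + 1" using u by (auto simp: cycle_vertices_def)
    moreover have "\<bar>real (dip n R (u + 1)) - real (dip n R u)\<bar> \<le> of_bool (u \<in> ?J)"
      using u False by (auto simp: dip_def cycle_vertices_def min_def split: if_splits)
    ultimately show ?thesis
      by (cases "u \<in> ?J") (auto simp: abs_square_le_1)
  qed
  then have "(\<Sum>u\<in>cycle_vertices n. (real (dip n R ((u + 1) mod int n)) - real (dip n R u))\<^sup>2)
    \<le> (\<Sum>u\<in>cycle_vertices n. of_bool (u \<in> ?J))"
    by (rule sum_mono)
  also have "\<dots> = real (card (cycle_vertices n \<inter> ?J))"
    by (simp add: of_bool_def sum.If_cases Int_def)
  also have "card (cycle_vertices n \<inter> ?J) \<le> card ?J"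
    by (intro card_mono) auto
  also have "card ?J \<le> 2 * R"
    by (rule order_trans[OF card_Un_le]) simp
  finally show ?thesis by simp
qed

section \<open>Hellinger estimate for the change of a cut weight under the noise\<close>

lemma expectation_challenge_fst:
  fixes f :: "int \<Rightarrow> real"
  assumes "n > 0"
  shows "measure_pmf.expectation (odd_cycle_challenge n) (\<lambda>q. f (fst q)) =
    (\<Sum>u\<in>cycle_vertices n. f u) / real n"
  unfolding expectation_odd_cycle_challenge[OF assms] by simp

lemma expectation_challenge_snd:
  fixes f :: "int \<Rightarrow> real"
  assumes "n > 0"
  shows "measure_pmf.expectation (odd_cycle_challenge n) (\<lambda>q. f (snd q)) =
    (\<Sum>u\<in>cycle_vertices n. f u) / real n"
  unfolding expectation_odd_cycle_challenge[OF assms]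
  using sum_cycle_shift[of f 1 n] sum_cycle_shift[of f "-1" n]
  by (simp add: sum.distrib sum_divide_distrib[symmetric])

lemma prod_list_map_mult:
  fixes f g :: "'a \<Rightarrow> 'b :: comm_monoid_mult"
  shows "prod_list (map (\<lambda>x. f x * g x) xs) = prod_list (map f xs) * prod_list (map g xs)"
  by (induction xs) (simp_all add: ac_simps)

lemma cut_weight_mset:
  "real (cut_weight n R p (mset xs)) = prod_list (map (\<lambda>u. real (dip n R ((u - p) mod int n)) ^ 2) xs)"
  by (induction xs) (simp_all add: cut_weight_def)

lemma challenges_integrable:
  fixes f :: "(int \<times> int) list \<Rightarrow> real"
  assumes "n > 0"
  shows "integrable (measure_pmf (replicate_pmf t (odd_cycle_challenge n))) f"
  using finite_set_replicate_pmf[OF finite_set_pmf_odd_cycle_challenge[OF assms]]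
  by (rule integrable_measure_pmf_finite)

text \<open>The weights are squares of product amplitudes \<open>A\<close> and \<open>B\<close>, and
  \<open>\<bar>A\<^sup>2 - B\<^sup>2\<bar>\<close> is the product of
  \<open>\<bar>A - B\<bar>\<close> and \<open>\<bar>A + B\<bar>\<close>. The mean square of the
  difference is controlled by the cross moment of \<open>A\<close> and \<open>B\<close>, which
  factorizes over the points; so the points contribute \<open>t * \<eta> / \<gamma>\<close> in
  square, and the root is taken only at the end.\<close>

lemma expectation_cut_weight_diff:
  assumes R: "R > 0" and n: "4 * R \<le> n"
  shows "measure_pmf.expectation (replicate_pmf t (odd_cycle_challenge n))
      (\<lambda>qs. \<bar>real (cut_weight n R p (mset (map fst qs))) - real (cut_weight n R p (mset (map snd qs)))\<bar>)
    \<le> 2 * sqrt (2 * real t / (real n * real R)) * (real (dip_mass n R) / real n) ^ t"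
proof (cases "t = 0")
  case False
  have n0: "n > 0" using R n by simp
  let ?\<mu> = "odd_cycle_challenge n"
  let ?E = "measure_pmf.expectation (replicate_pmf t ?\<mu>)"
  have int: "integrable (measure_pmf (replicate_pmf t ?\<mu>)) f" "integrable (measure_pmf ?\<mu>) f'"
    for f :: "(int \<times> int) list \<Rightarrow> real" and f' :: "int \<times> int \<Rightarrow> real"
    using challenges_integrable[OF n0] finite_set_pmf_odd_cycle_challenge[OF n0]
    by (auto intro: integrable_measure_pmf_finite)
  define \<alpha> where "\<alpha> u = real (dip n R ((u - p) mod int n))" for u
  define \<gamma> where "\<gamma> = real (dip_mass n R) / real n"
  define \<eta> where "\<eta> = measure_pmf.expectation ?\<mu> (\<lambda>q. (\<alpha> (fst q) - \<alpha> (snd q))\<^sup>2)"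
  have fst2: "measure_pmf.expectation ?\<mu> (\<lambda>q. \<alpha> (fst q) ^ 2) = \<gamma>"
    using expectation_challenge_fst[OF n0, of "\<lambda>u. \<alpha> u ^ 2"]
      sum_dip_shift[of "\<lambda>x. real x ^ 2" n R p] by (simp add: \<alpha>_def \<gamma>_def dip_mass_def)
  have snd2: "measure_pmf.expectation ?\<mu> (\<lambda>q. \<alpha> (snd q) ^ 2) = \<gamma>"
    using expectation_challenge_snd[OF n0, of "\<lambda>u. \<alpha> u ^ 2"]
      sum_dip_shift[of "\<lambda>x. real x ^ 2" n R p] by (simp add: \<alpha>_def \<gamma>_def dip_mass_def)
  have "\<eta> = measure_pmf.expectation ?\<mu> (\<lambda>q. \<alpha> (fst q) ^ 2 + \<alpha> (snd q) ^ 2 - 2 * (\<alpha> (fst q) * \<alpha> (snd q)))"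
    unfolding \<eta>_def by (simp add: power2_diff algebra_simps)
  then have cross: "measure_pmf.expectation ?\<mu> (\<lambda>q. \<alpha> (fst q) * \<alpha> (snd q)) = \<gamma> - \<eta> / 2"
    by (simp add: int fst2 snd2 field_simps)
  \<comment> \<open>Forward and backward steps have probability 1/4 each, and by rotation each sums
    to \<open>?S\<close>, whence \<open>?S / (2 * n)\<close>.\<close>
  have \<eta>_le: "\<eta> \<le> real R / real n"
  proof -
    let ?S = "\<Sum>u\<in>cycle_vertices n. (real (dip n R ((u + 1) mod int n)) - real (dip n R u))\<^sup>2"
    define F where "F u = (\<alpha> u - \<alpha> ((u + 1) mod int n))\<^sup>2" for u
    have "(\<Sum>u\<in>cycle_vertices n. F u) = ?S"
    proof -
      have "F u = (real (dip n R (((u + -p) mod int n + 1) mod int n)) - real (dip n R ((u + -p) mod int n)))\<^sup>2" for u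
        by (simp add: F_def \<alpha>_def mod_simps power2_commute algebra_simps)
      then show ?thesis
        by (simp only: sum_cycle_shift[of "\<lambda>u. (real (dip n R ((u + 1) mod int n)) - real (dip n R u))\<^sup>2" "-p"])
    qed
    moreover have "(\<Sum>u\<in>cycle_vertices n. (\<alpha> u - \<alpha> ((u - 1) mod int n))\<^sup>2) = (\<Sum>u\<in>cycle_vertices n. F u)"
    proof -
      have "(\<alpha> u - \<alpha> ((u - 1) mod int n))\<^sup>2 = F ((u + -1) mod int n)" if "u \<in> cycle_vertices n" for u
        using that by (simp add: F_def mod_simps power2_commute cycle_vertices_def)
      then show ?thesis by (simp add: sum_cycle_shift[of F "-1", symmetric])
    qed
    ultimately have "\<eta> = ?S / (2 * real n)"
      unfolding \<eta>_def expectation_odd_cycle_challenge[OF n0]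
      by (simp add: sum.distrib sum_divide_distrib[symmetric] F_def)
    also have "\<dots> \<le> 2 * real R / (2 * real n)"
      using sum_dip_increment[OF n0, of R] n0 by (intro divide_right_mono) auto
    finally show ?thesis using n0 by simp
  qed
  have "real R ^ 2 * (real n / 2) \<le> real R ^ 2 * (real n - 2 * real R)"
    using n by (intro mult_left_mono) auto
  also have "\<dots> \<le> real (dip_mass n R)" using dip_mass_ge n by simp
  finally have \<gamma>_ge: "real R ^ 2 / 2 \<le> \<gamma>" using n0 by (simp add: \<gamma>_def field_simps)
  have \<gamma>0: "\<gamma> > 0" using R by (intro less_le_trans[OF _ \<gamma>_ge]) simp
  have \<eta>0: "\<eta> \<ge> 0" by (simp add: \<eta>_def)
  define s where "s = sqrt (2 * real t / (real n * real R))"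
  have s0: "s > 0" using R n0 False by (simp add: s_def)
  have s2: "real t * \<eta> / \<gamma> \<le> s\<^sup>2"
  proof -
    have "\<eta> / \<gamma> \<le> (real R / real n) / (real R ^ 2 / 2)"
      using \<eta>_le \<gamma>_ge R \<eta>0 by (intro frac_le) auto
    also have "\<dots> = 2 / (real n * real R)" using R by (simp add: power2_eq_square)
    finally have "real t * (\<eta> / \<gamma>) \<le> real t * (2 / (real n * real R))" by (intro mult_left_mono) auto
    then show ?thesis by (simp add: s_def field_simps)
  qed
  define A where "A qs = prod_list (map (\<lambda>q. \<alpha> (fst q)) qs)" for qs :: "(int \<times> int) list"
  define B where "B qs = prod_list (map (\<lambda>q. \<alpha> (snd q)) qs)" for qs :: "(int \<times> int) list"
  have wA: "real (cut_weight n R p (mset (map fst qs))) = A qs ^ 2" for qs :: "(int \<times> int) list"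
    unfolding cut_weight_mset A_def power2_eq_square prod_list_map_mult[symmetric]
    by (simp add: \<alpha>_def o_def)
  have wB: "real (cut_weight n R p (mset (map snd qs))) = B qs ^ 2" for qs :: "(int \<times> int) list"
    unfolding cut_weight_mset B_def power2_eq_square prod_list_map_mult[symmetric]
    by (simp add: \<alpha>_def o_def)
  note prod = expectation_replicate_pmf_prod_list[OF finite_set_pmf_odd_cycle_challenge[OF n0]]
  have EA: "?E (\<lambda>qs. A qs ^ 2) = \<gamma> ^ t"
    unfolding A_def power2_eq_square prod_list_map_mult[symmetric] prod
    using fst2 by (simp add: power2_eq_square)
  have EB: "?E (\<lambda>qs. B qs ^ 2) = \<gamma> ^ t"
    unfolding B_def power2_eq_square prod_list_map_mult[symmetric] prod
    using snd2 by (simp add: power2_eq_square)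
  have EAB: "?E (\<lambda>qs. A qs * B qs) = (\<gamma> - \<eta> / 2) ^ t"
    unfolding A_def B_def prod_list_map_mult[symmetric] prod cross ..
  \<comment> \<open>Bernoulli's inequality needs \<open>\<eta> / (2 * \<gamma>) \<le> 1\<close>;
    this holds because the cross moment is nonnegative.\<close>
  have "\<gamma> - \<eta> / 2 = measure_pmf.expectation ?\<mu> (\<lambda>q. \<alpha> (fst q) * \<alpha> (snd q))" by (simp add: cross)
  also have "\<dots> \<ge> 0" by (simp add: \<alpha>_def)
  finally have "\<eta> / (2 * \<gamma>) \<le> 1" using \<gamma>0 by (simp add: field_simps)
  then have "1 - real t * (\<eta> / (2 * \<gamma>)) \<le> (1 - \<eta> / (2 * \<gamma>)) ^ t"
    using Bernoulli_inequality[of "- (\<eta> / (2 * \<gamma>))" t] by simp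
  then have "\<gamma> ^ t * (1 - real t * (\<eta> / (2 * \<gamma>))) \<le> \<gamma> ^ t * (1 - \<eta> / (2 * \<gamma>)) ^ t"
    using \<gamma>0 by (intro mult_left_mono) auto
  also have "\<dots> = ?E (\<lambda>qs. A qs * B qs)"
  proof -
    have "\<gamma> * (1 - \<eta> / (2 * \<gamma>)) = \<gamma> - \<eta> / 2" using \<gamma>0 by (simp add: field_simps)
    then show ?thesis unfolding EAB power_mult_distrib[symmetric] by simp
  qed
  finally have AB: "\<gamma> ^ t * (1 - real t * (\<eta> / (2 * \<gamma>))) \<le> ?E (\<lambda>qs. A qs * B qs)" .
  have minus: "?E (\<lambda>qs. (A qs - B qs)\<^sup>2) \<le> \<gamma> ^ t * s\<^sup>2"
  proof -
    have "?E (\<lambda>qs. (A qs - B qs)\<^sup>2) = ?E (\<lambda>qs. A qs ^ 2 + B qs ^ 2 - 2 * (A qs * B qs))"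
      by (simp add: power2_diff algebra_simps)
    also have "\<dots> = 2 * \<gamma> ^ t - 2 * ?E (\<lambda>qs. A qs * B qs)" by (simp add: int EA EB)
    also have "\<dots> \<le> 2 * \<gamma> ^ t - 2 * (\<gamma> ^ t * (1 - real t * (\<eta> / (2 * \<gamma>))))"
      using AB by linarith
    also have "\<dots> = \<gamma> ^ t * (real t * \<eta> / \<gamma>)"
      by (simp add: right_diff_distrib)
    also have "\<dots> \<le> \<gamma> ^ t * s\<^sup>2" using s2 \<gamma>0 by (intro mult_left_mono) auto
    finally show ?thesis .
  qed
  have plus: "?E (\<lambda>qs. (A qs + B qs)\<^sup>2) \<le> 4 * \<gamma> ^ t"
  proof -
    have "?E (\<lambda>qs. (A qs + B qs)\<^sup>2) \<le> ?E (\<lambda>qs. 2 * A qs ^ 2 + 2 * B qs ^ 2)"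
    proof (rule integral_mono)
      show "(A qs + B qs)\<^sup>2 \<le> 2 * A qs ^ 2 + 2 * B qs ^ 2" for qs
        using zero_le_power2[of "A qs - B qs"] by (simp add: power2_diff power2_sum)
    qed (auto simp: int)
    then show ?thesis by (simp add: int EA EB)
  qed
  have "?E (\<lambda>qs. \<bar>A qs ^ 2 - B qs ^ 2\<bar>) \<le> ?E (\<lambda>qs. (A qs - B qs)\<^sup>2 / s + (A qs + B qs)\<^sup>2 * (s / 4))"
  proof (rule integral_mono)
    fix qs
    \<comment> \<open>Weighted AM-GM by completing the square. The weight \<open>s\<close> balances
      the two mean squares, at most \<open>\<gamma> ^ t * s\<^sup>2\<close> and
      \<open>4 * \<gamma> ^ t\<close>.\<close>
    have square: "(X / s - Y / 2)\<^sup>2 * s = X\<^sup>2 / s + Y\<^sup>2 * (s / 4) - X * Y" for X Y :: real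
      using s0 by (simp add: power2_eq_square field_simps)
    have "0 \<le> (\<bar>A qs - B qs\<bar> / s - \<bar>A qs + B qs\<bar> / 2)\<^sup>2 * s" using s0 by simp
    also have "\<dots> = (A qs - B qs)\<^sup>2 / s + (A qs + B qs)\<^sup>2 * (s / 4) - \<bar>A qs - B qs\<bar> * \<bar>A qs + B qs\<bar>"
      unfolding square power2_abs ..
    also have "\<bar>A qs - B qs\<bar> * \<bar>A qs + B qs\<bar> = \<bar>A qs ^ 2 - B qs ^ 2\<bar>"
      by (simp add: abs_mult[symmetric] power2_eq_square algebra_simps)
    finally show "\<bar>A qs ^ 2 - B qs ^ 2\<bar> \<le> (A qs - B qs)\<^sup>2 / s + (A qs + B qs)\<^sup>2 * (s / 4)" by simp
  qed (auto simp: int)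
  also have "\<dots> = ?E (\<lambda>qs. (A qs - B qs)\<^sup>2) / s + ?E (\<lambda>qs. (A qs + B qs)\<^sup>2) * (s / 4)"
    by (simp add: int)
  also have "\<dots> \<le> \<gamma> ^ t * s\<^sup>2 / s + (4 * \<gamma> ^ t) * (s / 4)"
    using minus plus s0 by (intro add_mono divide_right_mono mult_right_mono) auto
  also have "\<dots> = 2 * s * \<gamma> ^ t" using s0 by (simp add: power2_eq_square)
  finally show ?thesis unfolding wA wB s_def \<gamma>_def .
qed simp

section \<open>Second moment of the total cut weight\<close>

lemma dip_less_imp_near:
  assumes "n > 0" "dip n R (x mod int n) < R"
  shows "\<exists>i\<in>{- int R..<int R}. x mod int n = i mod int n"
proof (cases "x mod int n < int R")
  case True
  moreover have "0 \<le> x mod int n" using assms(1) by simp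
  ultimately have "x mod int n \<in> {- int R..<int R}" unfolding atLeastLessThan_iff by linarith
  then show ?thesis by (intro bexI[of _ "x mod int n"]) simp
next
  case False
  have "x mod int n < int n" using assms(1) by simp
  with False show ?thesis using assms(2)
    by (intro bexI[of _ "x mod int n - int n"]) (auto simp: dip_def mod_simps)
qed

text \<open>A vertex close to both cuts has offsets from them in \<open>{- R..<R}\<close>, so
  \<open>q\<close> differs from \<open>p\<close>, modulo \<open>n\<close>, by an integer between
  \<open>-2 * R\<close> and \<open>2 * R\<close>.\<close>

lemma card_overlapping_dips:
  assumes n: "n > 0"
  shows "card {q \<in> cycle_vertices n. \<exists>u. dip n R ((u - p) mod int n) < R \<and> dip n R ((u - q) mod int n) < R}
    \<le> 4 * R + 1" (is "card ?N \<le> _")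
proof -
  have "?N \<subseteq> (\<lambda>k. (p + k) mod int n) ` {- 2 * int R..2 * int R}"
  proof
    fix q assume "q \<in> ?N"
    then obtain u where q: "q \<in> cycle_vertices n" "dip n R ((u - p) mod int n) < R" "dip n R ((u - q) mod int n) < R"
      by auto
    obtain i j where ij: "i \<in> {- int R..<int R}" "(u - p) mod int n = i mod int n"
      "j \<in> {- int R..<int R}" "(u - q) mod int n = j mod int n"
      using dip_less_imp_near[OF n q(2)] dip_less_imp_near[OF n q(3)] by blast
    have "(p + (i - j)) mod int n = (p + (i mod int n - j mod int n)) mod int n"
      by (intro mod_add_cong mod_diff_cong refl) simp_all
    also have "\<dots> = (p + ((u - p) - (u - q))) mod int n"
      unfolding ij(2,4)[symmetric] by (intro mod_add_cong mod_diff_cong refl) simp_all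
    also have "\<dots> = q mod int n" by simp
    also have "\<dots> = q" using q(1) by (simp add: cycle_vertices_def)
    finally show "q \<in> (\<lambda>k. (p + k) mod int n) ` {- 2 * int R..2 * int R}"
      using ij(1,3) by (intro image_eqI[of _ _ "i - j"]) auto
  qed
  then have "card ?N \<le> card ((\<lambda>k. (p + k) mod int n) ` {- 2 * int R..2 * int R})"
    by (intro card_mono) auto
  also have "\<dots> \<le> card {- 2 * int R..2 * int R}" by (rule card_image_le) simp
  also have "\<dots> = 4 * R + 1" by simp
  finally show ?thesis .
qed

text \<open>The first bound uses only that the squared \<open>dip\<close> is at most
  \<open>R ^ 2\<close>. For the second, the deficits below \<open>R ^ 2\<close> have disjoint
  supports, so their product vanishes and \<open>m\<close> equals
  \<open>\<gamma>\<^sup>2 - (\<gamma> - R\<^sup>2)\<^sup>2\<close>: distant cuts are negatively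
  correlated.\<close>

lemma dip_correlation:
  fixes n R :: nat and p q :: int
  defines "m \<equiv> (\<Sum>u\<in>cycle_vertices n. real (dip n R ((u - p) mod int n)) ^ 2 * real (dip n R ((u - q) mod int n)) ^ 2) / real n"
    and "\<gamma> \<equiv> real (dip_mass n R) / real n"
  assumes n: "n > 0"
  shows "m \<le> real R ^ 2 * \<gamma>"
    and "(\<And>u. dip n R ((u - p) mod int n) < R \<Longrightarrow> dip n R ((u - q) mod int n) < R \<Longrightarrow> False) \<Longrightarrow> m \<le> \<gamma> ^ 2"
proof -
  define x where "x r u = real (dip n R ((u - r) mod int n)) ^ 2" for r u
  have mean: "(\<Sum>u\<in>cycle_vertices n. x r u) = real n * \<gamma>" for r
    using sum_dip_shift[of "\<lambda>x. real x ^ 2" n R r] n by (simp add: x_def \<gamma>_def dip_mass_def)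
  have x_le: "x r u \<le> real R ^ 2" for r u
    unfolding x_def using dip_le by (intro power_mono) auto
  have x0: "x r u \<ge> 0" for r u by (simp add: x_def)
  have m: "m = (\<Sum>u\<in>cycle_vertices n. x p u * x q u) / real n" by (simp add: m_def x_def)
  have "(\<Sum>u\<in>cycle_vertices n. x p u * x q u) \<le> (\<Sum>u\<in>cycle_vertices n. real R ^ 2 * x q u)"
    using x_le x0 by (intro sum_mono mult_right_mono)
  also have "\<dots> = real n * (real R ^ 2 * \<gamma>)" by (simp add: sum_distrib_left[symmetric] mean)
  finally show "m \<le> real R ^ 2 * \<gamma>" using n by (simp add: m field_simps)
  assume disj: "\<And>u. dip n R ((u - p) mod int n) < R \<Longrightarrow> dip n R ((u - q) mod int n) < R \<Longrightarrow> False"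
  have "(real R ^ 2 - x p u) * (real R ^ 2 - x q u) = 0" for u
  proof -
    have "dip n R ((u - p) mod int n) = R \<or> dip n R ((u - q) mod int n) = R"
      using disj[of u] dip_le[of n R "(u - p) mod int n"] dip_le[of n R "(u - q) mod int n"]
      by (meson le_neq_implies_less)
    then show ?thesis by (auto simp: x_def)
  qed
  then have "x p u * x q u = real R ^ 2 * x p u + real R ^ 2 * x q u - real R ^ 2 * real R ^ 2" for u
    by (simp add: algebra_simps)
  then have "(\<Sum>u\<in>cycle_vertices n. x p u * x q u)
    = real R ^ 2 * (real n * \<gamma>) + real R ^ 2 * (real n * \<gamma>) - real n * (real R ^ 2 * real R ^ 2)"
    by (simp add: sum.distrib sum_subtractf sum_distrib_left[symmetric] mean)
  then have "m = 2 * real R ^ 2 * \<gamma> - real R ^ 2 * real R ^ 2" using n by (simp add: m field_simps)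
  moreover have "0 \<le> (\<gamma> - real R ^ 2)\<^sup>2" by simp
  ultimately show "m \<le> \<gamma> ^ 2" by (simp add: power2_diff power2_eq_square algebra_simps)
qed

text \<open>Expand the square over pairs of cuts; each mixed moment is a \<open>t\<close>-th power.
  Pairs of distant cuts contribute at most the product of the means, and each cut has at most
  \<open>4 * R + 1\<close> near ones, which exceed that product by at most the factor
  \<open>\<rho>\<close>.\<close>

lemma variance_total_cut_weight:
  fixes n R t :: nat
  defines "\<gamma> \<equiv> real (dip_mass n R) / real n"
  assumes n: "n > 0" and \<gamma>0: "\<gamma> > 0"
  shows "measure_pmf.expectation (replicate_pmf t (odd_cycle_challenge n))
      (\<lambda>qs. ((\<Sum>p\<in>cycle_vertices n. real (cut_weight n R p (mset (map fst qs)))) / (real n * \<gamma> ^ t) - 1)\<^sup>2)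
    \<le> (4 * real R + 1) / real n * (real R ^ 2 / \<gamma>) ^ t"
proof -
  let ?V = "cycle_vertices n"
  let ?E = "measure_pmf.expectation (replicate_pmf t (odd_cycle_challenge n))"
  note int = challenges_integrable[OF n]
  note prod = expectation_replicate_pmf_prod_list[OF finite_set_pmf_odd_cycle_challenge[OF n]]
  define N where "N p qs = real (cut_weight n R p (mset (map fst qs)))" for p and qs :: "(int \<times> int) list"
  define x where "x p u = real (dip n R ((u - p) mod int n)) ^ 2" for p u
  have N: "N p qs = prod_list (map (\<lambda>z. x p (fst z)) qs)" for p qs
    unfolding N_def cut_weight_mset by (simp add: x_def o_def)
  have EN: "?E (N p) = \<gamma> ^ t" for p
    unfolding N prod expectation_challenge_fst[OF n, of "x p"]
    using sum_dip_shift[of "\<lambda>x. real x ^ 2" n R p] by (simp add: x_def \<gamma>_def dip_mass_def)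
  define m where "m p q = (\<Sum>u\<in>?V. x p u * x q u) / real n" for p q
  have ENN: "?E (\<lambda>qs. N p qs * N q qs) = m p q ^ t" for p q
    unfolding N prod_list_map_mult[symmetric] prod
      expectation_challenge_fst[OF n, of "\<lambda>u. x p u * x q u"] m_def ..
  define near where "near p q \<longleftrightarrow> (\<exists>u. dip n R ((u - p) mod int n) < R \<and> dip n R ((u - q) mod int n) < R)" for p q
  have m0: "m p q \<ge> 0" for p q by (auto simp: m_def x_def intro!: divide_nonneg_nonneg sum_nonneg)
  define \<rho> where "\<rho> = (real R ^ 2 / \<gamma>) ^ t"
  have \<rho>0: "\<rho> \<ge> 0" using \<gamma>0 by (simp add: \<rho>_def)
  have m_le: "m p q ^ t \<le> \<gamma> ^ (2 * t) * (1 + of_bool (near p q) * \<rho>)" for p q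
  proof (cases "near p q")
    case True
    have "m p q ^ t \<le> (real R ^ 2 * \<gamma>) ^ t"
      using dip_correlation(1)[OF n, of R p q] m0 by (intro power_mono) (auto simp: m_def x_def \<gamma>_def)
    also have "\<dots> = \<gamma> ^ (2 * t) * \<rho>"
      unfolding \<rho>_def power_mult power_mult_distrib[symmetric] using \<gamma>0 by (simp add: power2_eq_square mult.commute)
    also have "\<dots> \<le> \<gamma> ^ (2 * t) * (1 + \<rho>)" using \<gamma>0 by (intro mult_left_mono) auto
    finally show ?thesis using True by simp
  next
    case False
    have "m p q ^ t \<le> (\<gamma>\<^sup>2) ^ t"
      using dip_correlation(2)[OF n, of R p q] m0 False
      by (intro power_mono) (auto simp: m_def x_def \<gamma>_def near_def)
    then show ?thesis using False by (simp add: power_mult)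
  qed
  have "?E (\<lambda>qs. (\<Sum>p\<in>?V. N p qs)\<^sup>2) = (\<Sum>p\<in>?V. \<Sum>q\<in>?V. m p q ^ t)"
    by (simp add: power2_eq_square sum_product int ENN)
  also have "\<dots> \<le> (\<Sum>p\<in>?V. \<Sum>q\<in>?V. \<gamma> ^ (2 * t) * (1 + of_bool (near p q) * \<rho>))"
    by (intro sum_mono m_le)
  also have "\<dots> = \<gamma> ^ (2 * t) * (\<Sum>p\<in>?V. real n + real (card {q \<in> ?V. near p q}) * \<rho>)"
    by (simp add: sum_distrib_left[symmetric] sum.distrib sum_distrib_right[symmetric] of_bool_def sum.If_cases Int_def)
  also have "\<dots> \<le> \<gamma> ^ (2 * t) * (\<Sum>p\<in>?V. real n + real (4 * R + 1) * \<rho>)"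
  proof (intro mult_left_mono sum_mono add_left_mono mult_right_mono)
    show "real (card {q \<in> ?V. near p q}) \<le> real (4 * R + 1)" for p
      unfolding near_def of_nat_le_iff by (rule card_overlapping_dips[OF n])
  qed (use \<rho>0 \<gamma>0 in auto)
  finally have second: "?E (\<lambda>qs. (\<Sum>p\<in>?V. N p qs)\<^sup>2) \<le> \<gamma> ^ (2 * t) * (real n * (real n + (4 * real R + 1) * \<rho>))"
    by (simp add: add.commute[of 1])
  have "?E (\<lambda>qs. ((\<Sum>p\<in>?V. N p qs) / (real n * \<gamma> ^ t) - 1)\<^sup>2)
    = ?E (\<lambda>qs. (\<Sum>p\<in>?V. N p qs)\<^sup>2 / (real n * \<gamma> ^ t)\<^sup>2 - 2 * ((\<Sum>p\<in>?V. N p qs) / (real n * \<gamma> ^ t)) + 1)"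
    by (intro Bochner_Integration.integral_cong refl) (simp add: power2_diff power_divide)
  also have "\<dots> = ?E (\<lambda>qs. (\<Sum>p\<in>?V. N p qs)\<^sup>2) / (real n * \<gamma> ^ t)\<^sup>2 - 1"
    using n \<gamma>0 by (simp add: int EN)
  also have "\<dots> \<le> \<gamma> ^ (2 * t) * (real n * (real n + (4 * real R + 1) * \<rho>)) / (real n * \<gamma> ^ t)\<^sup>2 - 1"
    using second by (intro diff_right_mono divide_right_mono) auto
  also have "\<dots> = (4 * real R + 1) / real n * \<rho>"
  proof -
    have "\<gamma> ^ (2 * t) = (\<gamma> ^ t)\<^sup>2" by (simp add: power_mult[symmetric] mult.commute)
    then show ?thesis using n \<gamma>0 by (simp add: power_mult_distrib field_simps power2_eq_square)
  qed
  finally show ?thesis unfolding N_def \<rho>_def .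
qed

section \<open>Cuts crossed by a challenge\<close>

text \<open>These are the challenges on which the parity labelling from \<open>p\<close>, used by
  both provers, violates the constraint.\<close>

definition crossing :: "nat \<Rightarrow> int \<Rightarrow> int \<times> int \<Rightarrow> bool" where
  "crossing n p z \<longleftrightarrow> fst z \<noteq> snd z \<and> odd ((fst z - p) mod int n) = odd ((snd z - p) mod int n)"

text \<open>A step changes the parity of the residue unless it wraps between \<open>n - 1\<close>
  and \<open>0\<close>. Both of these have \<open>dip\<close> zero, and the endpoint with residue
  \<open>0\<close> is \<open>p\<close> itself.\<close>

lemma crossingD:
  assumes n: "n > 0" and z: "z \<in> set_pmf (odd_cycle_challenge n)" and p: "p \<in> cycle_vertices n"
    and cross: "crossing n p z"
  shows "dip n R ((fst z - p) mod int n) = 0" "p \<in> {fst z, snd z}"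
proof -
  obtain u v where uv: "z = (u, v)" by force
  define r where "r = (u - p) mod int n"
  have r: "0 \<le> r" "r < int n" using n by (auto simp: r_def)
  have V: "u \<in> cycle_vertices n" "v \<in> cycle_vertices n" and uv_ne: "u \<noteq> v"
    and parity: "odd r = odd ((v - p) mod int n)"
    using z n cross by (auto simp: uv set_pmf_odd_cycle_challenge crossing_def r_def)
  have eqI: "p = x" if "x \<in> cycle_vertices n" "(x - p) mod int n = 0" for x
  proof -
    have "x mod int n = p mod int n" using that(2) by (metis dvd_eq_mod_eq_0 mod_eq_dvd_iff)
    then show ?thesis using that(1) p by (simp add: cycle_vertices_def)
  qed
  consider "v = (u + 1) mod int n" | "v = (u - 1) mod int n"
    using z n uv_ne by (auto simp: uv set_pmf_odd_cycle_challenge)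
  then have "dip n R r = 0 \<and> p \<in> {u, v}"
  proof cases
    case 1
    then have v: "(v - p) mod int n = (r + 1) mod int n"
      by (simp add: r_def mod_simps algebra_simps)
    have "r = int n - 1"
    proof (rule ccontr)
      assume "r \<noteq> int n - 1"
      then have "(v - p) mod int n = r + 1" using v r by simp
      then show False using parity by simp
    qed
    moreover from this have "(v - p) mod int n = 0" using v by simp
    ultimately show ?thesis using eqI[OF V(2)] by (simp add: dip_def)
  next
    case 2
    then have v: "(v - p) mod int n = (r - 1) mod int n"
      by (simp add: r_def mod_simps algebra_simps)
    have "r = 0"
    proof (rule ccontr)
      assume "r \<noteq> 0"
      then have "(v - p) mod int n = r - 1" using v r by simp
      then show False using parity by simp
    qed
    then show ?thesis using eqI[OF V(1)] by (simp add: dip_def r_def)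
  qed
  then show "dip n R ((fst z - p) mod int n) = 0" "p \<in> {fst z, snd z}"
    by (simp_all add: uv r_def)
qed

text \<open>A crossed cut is one of the two endpoints of a pair that moved.\<close>

lemma card_crossing_cuts:
  assumes n: "n > 0" and qs: "set qs \<subseteq> set_pmf (odd_cycle_challenge n)"
  shows "card {p \<in> cycle_vertices n. \<exists>z\<in>set qs. crossing n p z}
    \<le> 2 * length (filter (\<lambda>z. fst z \<noteq> snd z) qs)"
proof -
  let ?zs = "filter (\<lambda>z. fst z \<noteq> snd z) qs"
  have "{p \<in> cycle_vertices n. \<exists>z\<in>set qs. crossing n p z} \<subseteq> set (map fst ?zs @ map snd ?zs)"
  proof
    fix p assume "p \<in> {p \<in> cycle_vertices n. \<exists>z\<in>set qs. crossing n p z}"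
    then obtain z where z: "p \<in> cycle_vertices n" "z \<in> set qs" "crossing n p z" by auto
    then have "p \<in> {fst z, snd z}" using crossingD(2)[OF n _ z(1,3)] qs by blast
    moreover have "z \<in> set ?zs" using z(2,3) by (simp add: crossing_def)
    ultimately show "p \<in> set (map fst ?zs @ map snd ?zs)" by force
  qed
  then have "card {p \<in> cycle_vertices n. \<exists>z\<in>set qs. crossing n p z} \<le> card (set (map fst ?zs @ map snd ?zs))"
    by (intro card_mono) auto
  also have "\<dots> \<le> length (map fst ?zs @ map snd ?zs)" by (rule card_length)
  finally show ?thesis by simp
qed

lemma cut_weight_crossing:
  assumes "n > 0" "set qs \<subseteq> set_pmf (odd_cycle_challenge n)" "p \<in> cycle_vertices n"
    and "\<exists>z\<in>set qs. crossing n p z"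
  shows "cut_weight n R p (mset (map fst qs)) = 0"
proof -
  obtain z where z: "z \<in> set qs" "crossing n p z" using assms(4) by auto
  have "dip n R ((fst z - p) mod int n) ^ 2 \<in># image_mset (\<lambda>u. dip n R ((u - p) mod int n) ^ 2) (mset (map fst qs))"
    using z(1) by (auto intro!: imageI)
  moreover have "dip n R ((fst z - p) mod int n) = 0"
    using crossingD(1)[OF assms(1) _ assms(3) z(2)] z(1) assms(2) by blast
  ultimately show ?thesis
    unfolding cut_weight_def prod_mset_zero_iff by simp
qed

section \<open>Sampling weights with a total bounded below\<close>

text \<open>With \<open>\<gamma> = dip_mass n R / n\<close> and \<open>W p = cut_weight n R p X / \<gamma> ^ t\<close>, this is
  \<open>W p + max 0 (1/2 - avg W)\<close>, scaled by \<open>2 * n * dip_mass n R ^ t\<close> to be a natural number. The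
  subtraction is truncated on purpose.\<close>

definition sampling_weight :: "nat \<Rightarrow> nat \<Rightarrow> nat \<Rightarrow> int multiset \<Rightarrow> int \<Rightarrow> nat" where
  "sampling_weight n R t X p = 2 * n ^ t * n * cut_weight n R p X
     + (n * dip_mass n R ^ t - 2 * n ^ t * (\<Sum>r\<in>cycle_vertices n. cut_weight n R r X))"

text \<open>For natural numbers \<open>a + (b - a) \<ge> b\<close>, so the top-up guarantees half of
  the mean total for every \<open>X\<close>. This provides the bound \<open>h\<close> for
  \<open>correlated_choice\<close>.\<close>

lemma sum_sampling_weight_ge:
  "n ^ 2 * dip_mass n R ^ t \<le> (\<Sum>p\<in>cycle_vertices n. sampling_weight n R t X p)"
proof -
  let ?S = "\<Sum>r\<in>cycle_vertices n. cut_weight n R r X"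
  have "(\<Sum>p\<in>cycle_vertices n. sampling_weight n R t X p)
    = n * (2 * n ^ t * ?S + (n * dip_mass n R ^ t - 2 * n ^ t * ?S))"
    by (simp add: sampling_weight_def sum.distrib sum_distrib_left[symmetric] algebra_simps)
  also have "\<dots> \<ge> n * (n * dip_mass n R ^ t)" by (intro mult_left_mono) auto
  finally show ?thesis by (simp add: power2_eq_square mult.assoc)
qed

text \<open>Truncated subtraction is 1-Lipschitz in the total, and the total changes by at most the
  sum of the individual changes. The \<open>n\<close> equal top-ups therefore cost as much as the
  cut weights themselves, and 4 is 2 + 2.\<close>

lemma sum_sampling_weight_diff:
  "(\<Sum>p\<in>cycle_vertices n. \<bar>real (sampling_weight n R t X p) - real (sampling_weight n R t Y p)\<bar>)
    \<le> 4 * real n ^ (t + 1) * (\<Sum>p\<in>cycle_vertices n. \<bar>real (cut_weight n R p X) - real (cut_weight n R p Y)\<bar>)"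
proof -
  let ?V = "cycle_vertices n"
  define S where "S X = (\<Sum>r\<in>?V. cut_weight n R r X)" for X
  define \<Delta> where "\<Delta> p = \<bar>real (cut_weight n R p X) - real (cut_weight n R p Y)\<bar>" for p
  have diff: "\<bar>real (a - b) - real (a - c)\<bar> \<le> \<bar>real b - real c\<bar>" for a b c :: nat
    by linarith
  have "\<bar>real (S X) - real (S Y)\<bar> = \<bar>\<Sum>r\<in>?V. real (cut_weight n R r X) - real (cut_weight n R r Y)\<bar>"
    by (simp add: S_def sum_subtractf)
  also have "\<dots> \<le> (\<Sum>p\<in>?V. \<Delta> p)" unfolding \<Delta>_def by (rule sum_abs)
  finally have S: "\<bar>real (S X) - real (S Y)\<bar> \<le> (\<Sum>p\<in>?V. \<Delta> p)" .
  have "\<bar>real (sampling_weight n R t X p) - real (sampling_weight n R t Y p)\<bar>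
    \<le> 2 * real n ^ t * real n * \<Delta> p + 2 * real n ^ t * (\<Sum>p\<in>?V. \<Delta> p)" for p
  proof -
    define T where "T X = n * dip_mass n R ^ t - 2 * n ^ t * S X" for X
    have "\<bar>real (T X) - real (T Y)\<bar> \<le> \<bar>real (2 * n ^ t * S X) - real (2 * n ^ t * S Y)\<bar>"
      unfolding T_def by (rule diff)
    also have "\<dots> = 2 * real n ^ t * \<bar>real (S X) - real (S Y)\<bar>"
      by (simp add: right_diff_distrib[symmetric] abs_mult)
    also have "\<dots> \<le> 2 * real n ^ t * (\<Sum>p\<in>?V. \<Delta> p)" using S by (intro mult_left_mono) auto
    finally have T: "\<bar>real (T X) - real (T Y)\<bar> \<le> 2 * real n ^ t * (\<Sum>p\<in>?V. \<Delta> p)" .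
    have "real (sampling_weight n R t X p) - real (sampling_weight n R t Y p)
      = 2 * real n ^ t * real n * (real (cut_weight n R p X) - real (cut_weight n R p Y)) + (real (T X) - real (T Y))"
      by (simp add: sampling_weight_def T_def S_def right_diff_distrib)
    also have "\<bar>\<dots>\<bar> \<le> 2 * real n ^ t * real n * \<Delta> p + \<bar>real (T X) - real (T Y)\<bar>"
      by (rule order_trans[OF abs_triangle_ineq]) (simp add: \<Delta>_def abs_mult)
    finally show ?thesis using T by linarith
  qed
  then have "(\<Sum>p\<in>?V. \<bar>real (sampling_weight n R t X p) - real (sampling_weight n R t Y p)\<bar>)
    \<le> (\<Sum>p\<in>?V. 2 * real n ^ t * real n * \<Delta> p + 2 * real n ^ t * (\<Sum>p\<in>?V. \<Delta> p))"
    by (rule sum_mono)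
  also have "\<dots> = 4 * real n ^ (t + 1) * (\<Sum>p\<in>?V. \<Delta> p)"
    by (simp add: sum.distrib sum_distrib_left[symmetric])
  finally show ?thesis by (simp add: \<Delta>_def)
qed

text \<open>Only the truncated part of the weight can sit on a crossed cut, and it is nonzero only where the
  total cut weight is at most half its mean; there \<open>max 0 (1 - 2 y) \<le> 4 (y - 1)\<^sup>2\<close>.\<close>

lemma sum_sampling_weight_crossing:
  fixes n R t :: nat
  defines "\<gamma> \<equiv> real (dip_mass n R) / real n"
  assumes n: "n > 0" and \<gamma>0: "\<gamma> > 0" and qs: "set qs \<subseteq> set_pmf (odd_cycle_challenge n)"
  shows "(\<Sum>p\<in>cycle_vertices n. real (sampling_weight n R t (mset (map fst qs)) p)
      * of_bool (\<exists>z\<in>set qs. crossing n p z))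
    \<le> 8 * real n * real (dip_mass n R) ^ t
      * (((\<Sum>p\<in>cycle_vertices n. real (cut_weight n R p (mset (map fst qs)))) / (real n * \<gamma> ^ t) - 1)\<^sup>2
        * real (length (filter (\<lambda>z. fst z \<noteq> snd z) qs)))"
proof -
  let ?V = "cycle_vertices n"
  let ?X = "mset (map fst qs)"
  define S where "S = (\<Sum>r\<in>?V. cut_weight n R r ?X)"
  define T where "T = n * dip_mass n R ^ t - 2 * n ^ t * S"
  define y where "y = real S / (real n * \<gamma> ^ t)"
  define k where "k = length (filter (\<lambda>z. fst z \<noteq> snd z) qs)"
  have G: "real (dip_mass n R) ^ t = real n ^ t * \<gamma> ^ t"
    using n by (simp add: \<gamma>_def power_mult_distrib[symmetric])
  have T: "real T \<le> real n * real (dip_mass n R) ^ t * (4 * (y - 1)\<^sup>2)"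
  proof (cases "2 * n ^ t * S \<le> n * dip_mass n R ^ t")
    case True
    have S: "real S = y * (real n * \<gamma> ^ t)" using n \<gamma>0 by (simp add: y_def)
    have "real T = real n * real (dip_mass n R) ^ t - 2 * real n ^ t * real S"
      using True by (simp add: T_def of_nat_diff)
    also have "\<dots> = real n * real (dip_mass n R) ^ t * (1 - 2 * y)"
      unfolding S G by (simp add: algebra_simps)
    also have "\<dots> \<le> real n * real (dip_mass n R) ^ t * (4 * (y - 1)\<^sup>2)"
    proof (rule mult_left_mono)
      \<comment> \<open>The right side minus the left side is
        \<open>4 * (y - 3/4)\<^sup>2 + 3/4\<close>.\<close>
      have "0 \<le> 4 * (y - 3/4)\<^sup>2" by simp
      then show "1 - 2 * y \<le> 4 * (y - 1)\<^sup>2" by (simp add: power2_eq_square algebra_simps)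
    qed simp
    finally show ?thesis .
  qed (simp add: T_def)
  have on_crossing: "real (sampling_weight n R t ?X p) * of_bool (\<exists>z\<in>set qs. crossing n p z)
      = real T * of_bool (\<exists>z\<in>set qs. crossing n p z)" if "p \<in> ?V" for p
    using cut_weight_crossing[OF n qs that, of R]
    by (cases "\<exists>z\<in>set qs. crossing n p z") (simp_all add: sampling_weight_def T_def S_def del: mset_map)
  have "(\<Sum>p\<in>?V. real (sampling_weight n R t ?X p) * of_bool (\<exists>z\<in>set qs. crossing n p z))
      = real T * (\<Sum>p\<in>?V. of_bool (\<exists>z\<in>set qs. crossing n p z))"
    unfolding sum_distrib_left by (rule sum.cong[OF refl on_crossing])
  also have "(\<Sum>p\<in>?V. of_bool (\<exists>z\<in>set qs. crossing n p z))
      = real (card {p \<in> ?V. \<exists>z\<in>set qs. crossing n p z})"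
    by (simp add: of_bool_def sum.If_cases Int_def)
  also have "real T * real (card {p \<in> ?V. \<exists>z\<in>set qs. crossing n p z})
      \<le> (real n * real (dip_mass n R) ^ t * (4 * (y - 1)\<^sup>2)) * real (2 * k)"
    using T card_crossing_cuts[OF n qs] unfolding k_def
    by (intro mult_mono) (auto simp only: of_nat_le_iff intro!: mult_nonneg_nonneg)
  finally show ?thesis by (simp add: y_def S_def k_def algebra_simps)
qed

section \<open>From a choice of cuts to a symmetric strategy and its value\<close>

lemma sym_odd_cycle_value_ge:
  assumes "A \<in> sym_strategies (cycle_vertices n) t" "B \<in> sym_strategies (cycle_vertices n) t"
  shows "sym_odd_cycle_accept_prob n t A B \<le> sym_odd_cycle_value n t"
proof -
  have "(\<lambda>(A, B). sym_odd_cycle_accept_prob n t A B) (A, B) \<le> sym_odd_cycle_value n t"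
    unfolding sym_odd_cycle_value_def
    by (rule cSUP_upper)
       (use assms in \<open>auto intro!: bdd_aboveI[of _ 1] simp: sym_odd_cycle_accept_prob_def\<close>)
  then show ?thesis by simp
qed

text \<open>\<open>mset\<close> is invariant under permutations of the tuple, and mapping a fixed
  function commutes with them.\<close>

lemma map_mset_sym_strategy:
  "(\<lambda>x. map (f (mset x)) x) \<in> sym_strategies Q t"
  by (auto simp: sym_strategies_def permute_list_map)

lemma sym_odd_cycle_value_nonneg: "0 \<le> sym_odd_cycle_value n t"
proof -
  let ?A = "\<lambda>x::int list. map (\<lambda>_. False) x"
  have "0 \<le> sym_odd_cycle_accept_prob n t ?A ?A" by (simp add: sym_odd_cycle_accept_prob_def)
  also have "\<dots> \<le> sym_odd_cycle_value n t"
    using map_mset_sym_strategy[of "\<lambda>_ _. False"] by (intro sym_odd_cycle_value_ge)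
  finally show ?thesis .
qed

text \<open>Both provers answer the parity of the residue relative to the cut that \<open>c\<close>
  assigns to their multiset. If the two cuts agree and no pair crosses, every constraint
  holds.\<close>

lemma cut_strategy_value:
  fixes c :: "int multiset \<Rightarrow> int"
  assumes n: "n > 0"
  shows "1 - (\<Sum>qs\<in>set_pmf (replicate_pmf t (odd_cycle_challenge n)).
      pmf (replicate_pmf t (odd_cycle_challenge n)) qs *
      of_bool (c (mset (map fst qs)) \<noteq> c (mset (map snd qs)) \<or>
        (\<exists>z\<in>set qs. crossing n (c (mset (map fst qs))) z)))
    \<le> sym_odd_cycle_value n t"
proof -
  let ?T = "replicate_pmf t (odd_cycle_challenge n)"
  define A where "A x = map (\<lambda>u. odd ((u - c (mset x)) mod int n)) x" for x
  define fails where "fails qs \<longleftrightarrow> c (mset (map fst qs)) \<noteq> c (mset (map snd qs)) \<or>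
        (\<exists>z\<in>set qs. crossing n (c (mset (map fst qs))) z)" for qs
  have A: "A \<in> sym_strategies (cycle_vertices n) t"
    unfolding A_def by (rule map_mset_sym_strategy[of "\<lambda>X u. odd ((u - c X) mod int n)"])
  have fin: "finite (set_pmf ?T)"
    using finite_set_replicate_pmf finite_set_pmf_odd_cycle_challenge n by blast
  have ok: "odd_cycle_accepts (qs ! i) (A (map fst qs) ! i) (A (map snd qs) ! i)"
    if "\<not> fails qs" "i < length qs" for qs i
  proof -
    have "\<not> crossing n (c (mset (map fst qs))) (qs ! i)" using that by (auto simp: fails_def)
    then show ?thesis
      using that by (auto simp: fails_def odd_cycle_accepts_def A_def crossing_def)
  qed
  have "1 - (\<Sum>qs\<in>set_pmf ?T. pmf ?T qs * of_bool (fails qs)) = 1 - measure_pmf.prob ?T {qs. fails qs}"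
  proof -
    have "measure_pmf.prob ?T {qs. fails qs} = measure_pmf.prob ?T ({qs. fails qs} \<inter> set_pmf ?T)"
      by (simp add: measure_Int_set_pmf)
    also have "\<dots> = (\<Sum>qs\<in>set_pmf ?T. pmf ?T qs * of_bool (fails qs))"
      using fin by (simp add: measure_measure_pmf_finite of_bool_def sum.If_cases Int_def if_distrib conj_commute cong: if_cong)
    finally show ?thesis by simp
  qed
  also have "\<dots> = measure_pmf.prob ?T {qs. \<not> fails qs}"
    by (subst measure_pmf.prob_compl[symmetric]) (auto intro!: arg_cong[of _ _ "measure_pmf.prob ?T"])
  also have "\<dots> = measure_pmf.prob ?T ({qs. \<not> fails qs} \<inter> set_pmf ?T)"
    by (simp add: measure_Int_set_pmf)
  also have "\<dots> \<le> sym_odd_cycle_accept_prob n t A A"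
    unfolding sym_odd_cycle_accept_prob_def
    by (rule measure_pmf.finite_measure_mono) (auto simp: set_replicate_pmf ok)
  also have "\<dots> \<le> sym_odd_cycle_value n t" by (rule sym_odd_cycle_value_ge[OF A A])
  finally show ?thesis unfolding fails_def .
qed

text \<open>Combines \<open>correlated_choice\<close> for the weights \<open>sampling_weight\<close>
  with the two estimates. The square root pays for the two provers choosing different cuts; the last
  term pays for crossed cuts and is the mean number \<open>t / 2\<close> of moved points times the
  relative variance, up to a factor of order \<open>1 / n\<close>.\<close>

lemma sym_odd_cycle_value_lower_bound:
  fixes n R t :: nat
  assumes R: "R > 0" and n4: "4 * R \<le> n"
  shows "1 - 8 * sqrt (2 * real t / (real n * real R))
      - 4 * (real t / real n) * ((4 * real R + 1) / real n * (real R ^ 2 * real n / real (dip_mass n R)) ^ t)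
    \<le> sym_odd_cycle_value n t"
proof -
  let ?V = "cycle_vertices n"
  let ?\<mu> = "odd_cycle_challenge n"
  let ?T = "replicate_pmf t ?\<mu>"
  let ?E = "measure_pmf.expectation ?T"
  have n: "n > 0" using R n4 by simp
  note int = challenges_integrable[OF n]
  have fin: "finite (set_pmf ?T)"
    using finite_set_replicate_pmf finite_set_pmf_odd_cycle_challenge n by blast
  define G where "G = dip_mass n R"
  define \<gamma> where "\<gamma> = real G / real n"
  have "0 < real R ^ 2 * (real n - 2 * real R)" using R n4 by simp
  also have "\<dots> \<le> real G" unfolding G_def using n4 by (intro dip_mass_ge) simp
  finally have G0: "G > 0" by simp
  then have \<gamma>0: "\<gamma> > 0" using n by (simp add: \<gamma>_def)
  have Gt: "real n ^ t * \<gamma> ^ t = real G ^ t"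
    using n by (simp add: \<gamma>_def power_mult_distrib[symmetric])
  define h where "h = real n ^ 2 * real G ^ t"
  have h0: "h > 0" using n G0 by (simp add: h_def)
  define a b :: "(int \<times> int) list \<Rightarrow> int multiset" where "a qs = mset (map fst qs)" and "b qs = mset (map snd qs)" for qs
  define q where "q = sampling_weight n R t"
  define bad where "bad qs p \<longleftrightarrow> (\<exists>z\<in>set qs. crossing n p z)" for qs :: "(int \<times> int) list" and p
  define D where "D qs = (\<Sum>p\<in>?V. \<bar>real (q (a qs) p) - real (q (b qs) p)\<bar> + real (q (a qs) p) * of_bool (bad qs p)) / h" for qs
  \<comment> \<open>Any positive common bound on the finitely many weights suffices:
    \<open>M\<close> enters only through \<open>r\<close>, whose powers vanish in the limit.\<close>
  define M where "M = 1 + (\<Sum>qs\<in>set_pmf ?T. \<Sum>p\<in>?V. q (a qs) p + q (b qs) p)"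
  have M0: "M > 0" by (simp add: M_def)
  have upper: "q (a qs) p \<le> M" "q (b qs) p \<le> M" if "qs \<in> set_pmf ?T" "p \<in> ?V" for qs p
  proof -
    have "q (a qs) p + q (b qs) p \<le> (\<Sum>p\<in>?V. q (a qs) p + q (b qs) p)"
      using that by (intro member_le_sum) auto
    also have "\<dots> \<le> (\<Sum>qs\<in>set_pmf ?T. \<Sum>p\<in>?V. q (a qs) p + q (b qs) p)"
      using that fin by (intro member_le_sum[of qs "set_pmf ?T" "\<lambda>qs. \<Sum>p\<in>?V. q (a qs) p + q (b qs) p"]) auto
    finally show "q (a qs) p \<le> M" "q (b qs) p \<le> M" by (simp_all add: M_def)
  qed
  have lower: "h \<le> (\<Sum>p\<in>?V. real (q (a qs) p))" for qs
    using sum_sampling_weight_ge[of n R t "a qs"]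
    by (simp add: h_def q_def G_def of_nat_le_iff[where 'a = real, symmetric] del: of_nat_le_iff)
  define r where "r = 1 - h / (real n * real M)"
  have value_ge: "1 - (?E D + r ^ K) \<le> sym_odd_cycle_value n t" for K
  proof -
    obtain c where c: "(\<Sum>qs\<in>set_pmf ?T. pmf ?T qs * of_bool (c (a qs) \<noteq> c (b qs) \<or> bad qs (c (a qs))))
      \<le> (\<Sum>qs\<in>set_pmf ?T. pmf ?T qs * (D qs + r ^ K))"
      using correlated_choice[where E = "set_pmf ?T" and P = ?V and M = M and h = h and q = q and a = a
          and b = b and bad = bad and w = "pmf ?T" and K = K] fin n M0 h0 lower upper
      unfolding D_def r_def by auto
    have "(\<Sum>qs\<in>set_pmf ?T. pmf ?T qs * (D qs + r ^ K)) = ?E (\<lambda>qs. D qs + r ^ K)"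
      using fin by (simp add: integral_measure_pmf[of "set_pmf ?T"])
    also have "\<dots> = ?E D + r ^ K" by (simp add: int)
    finally have "(\<Sum>qs\<in>set_pmf ?T. pmf ?T qs * of_bool (c (a qs) \<noteq> c (b qs) \<or> bad qs (c (a qs)))) \<le> ?E D + r ^ K"
      using c by simp
    then show ?thesis using cut_strategy_value[OF n, of t c] unfolding a_def b_def bad_def by linarith
  qed
  have "\<bar>r\<bar> < 1"
  proof -
    have "h \<le> (\<Sum>p\<in>?V. real M)"
    proof -
      obtain qs where qs: "qs \<in> set_pmf ?T" using set_pmf_not_empty by fastforce
      have "(\<Sum>p\<in>?V. real (q (a qs) p)) \<le> (\<Sum>p\<in>?V. real M)"
        using upper(1)[OF qs] by (intro sum_mono) simp
      then show ?thesis using lower[of qs] by linarith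
    qed
    then have "h / (real n * real M) \<le> 1" using n M0 by simp
    moreover have "h / (real n * real M) > 0" using n M0 h0 by simp
    ultimately show ?thesis unfolding r_def by linarith
  qed
  \<comment> \<open>The strategy depends on \<open>K\<close>, but the value does not, so
    \<open>K\<close> may tend to infinity in the bound.\<close>
  then have "(\<lambda>K. 1 - (?E D + r ^ K)) \<longlonglongrightarrow> 1 - (?E D + 0)"
    by (intro tendsto_intros LIMSEQ_power_zero) auto
  then have value_D: "1 - ?E D \<le> sym_odd_cycle_value n t"
    using value_ge by (intro LIMSEQ_le_const2[where X = "\<lambda>K. 1 - (?E D + r ^ K)"]) auto
  define \<Delta> where "\<Delta> qs = (\<Sum>p\<in>?V. \<bar>real (cut_weight n R p (a qs)) - real (cut_weight n R p (b qs))\<bar>)" for qs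
  define W where "W xs = ((\<Sum>p\<in>?V. real (cut_weight n R p (mset xs))) / (real n * \<gamma> ^ t) - 1)\<^sup>2" for xs
  define k where "k qs = real (length (filter (\<lambda>z. fst z \<noteq> snd z) qs))" for qs :: "(int \<times> int) list"
  have "?E D \<le> ?E (\<lambda>qs. (4 * real n ^ (t + 1) * \<Delta> qs + 8 * real n * real G ^ t * (W (map fst qs) * k qs)) / h)"
  proof (intro integral_mono_AE int AE_pmfI)
    fix qs assume "qs \<in> set_pmf ?T"
    then have qs: "set qs \<subseteq> set_pmf ?\<mu>" by (auto simp: set_replicate_pmf)
    show "D qs \<le> (4 * real n ^ (t + 1) * \<Delta> qs + 8 * real n * real G ^ t * (W (map fst qs) * k qs)) / h"
      unfolding D_def sum.distrib q_def
      using h0 sum_sampling_weight_diff[of n R t "a qs" "b qs"]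
        sum_sampling_weight_crossing[OF n _ qs, of R t] \<gamma>0
      by (intro divide_right_mono add_mono) (auto simp: \<Delta>_def W_def k_def a_def bad_def G_def \<gamma>_def)
  qed
  also have "\<dots> = (4 * real n ^ (t + 1) * ?E \<Delta> + 8 * real n * real G ^ t * ?E (\<lambda>qs. W (map fst qs) * k qs)) / h"
    by (simp add: int)
  also have "\<dots> \<le> (4 * real n ^ (t + 1) * (real n * (2 * sqrt (2 * real t / (real n * real R)) * \<gamma> ^ t))
      + 8 * real n * real G ^ t * (1 / 2 * real t * ((4 * real R + 1) / real n * (real R ^ 2 / \<gamma>) ^ t))) / h"
  proof (intro divide_right_mono add_mono mult_left_mono)
    have "?E \<Delta> = (\<Sum>p\<in>?V. ?E (\<lambda>qs. \<bar>real (cut_weight n R p (a qs)) - real (cut_weight n R p (b qs))\<bar>))"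
      unfolding \<Delta>_def by (simp add: int)
    also have "\<dots> \<le> (\<Sum>p\<in>?V. 2 * sqrt (2 * real t / (real n * real R)) * \<gamma> ^ t)"
      unfolding a_def b_def \<gamma>_def G_def by (intro sum_mono expectation_cut_weight_diff R n4)
    finally show "?E \<Delta> \<le> real n * (2 * sqrt (2 * real t / (real n * real R)) * \<gamma> ^ t)" by simp
    \<comment> \<open>As \<open>n \<ge> 4\<close>, a step always changes the vertex, so a point
      moves with probability 1/2 independently of its start. \<open>W\<close> sees only the starts,
      so the factor splits off.\<close>
    have "measure_pmf.expectation ?\<mu> (\<lambda>z. f (fst z) * of_bool (fst z \<noteq> snd z))
        = 1 / 2 * measure_pmf.expectation ?\<mu> (\<lambda>z. f (fst z))" for f :: "int \<Rightarrow> real"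
    proof -
      have "u \<noteq> (u + 1) mod int n \<and> u \<noteq> (u - 1) mod int n" if "u \<in> ?V" for u
      proof -
        have "2 \<le> int n" "0 \<le> u" "u < int n" using that R n4 by (auto simp: cycle_vertices_def)
        then have "u mod int n = u" "\<not> int n dvd 1" "\<not> int n dvd -1" by auto
        then show ?thesis
          using mod_eq_dvd_iff[of "u + 1" "int n" u] mod_eq_dvd_iff[of "u - 1" "int n" u] by auto
      qed
      then show ?thesis
        unfolding expectation_odd_cycle_challenge[OF n]
        by (simp add: sum_divide_distrib[symmetric] cong: sum.cong)
    qed
    then have "?E (\<lambda>qs. W (map fst qs) * k qs) = 1 / 2 * real t * ?E (\<lambda>qs. W (map fst qs))"
      unfolding k_def
      by (intro expectation_replicate_pmf_length_filter finite_set_pmf_odd_cycle_challenge n)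
    also have "\<dots> \<le> 1 / 2 * real t * ((4 * real R + 1) / real n * (real R ^ 2 / \<gamma>) ^ t)"
      using variance_total_cut_weight[OF n, of R t] \<gamma>0 unfolding W_def \<gamma>_def G_def
      by (intro mult_left_mono) auto
    finally show "?E (\<lambda>qs. W (map fst qs) * k qs)
      \<le> 1 / 2 * real t * ((4 * real R + 1) / real n * (real R ^ 2 / \<gamma>) ^ t)" .
  qed (use h0 in auto)
  also have "\<dots> = 8 * sqrt (2 * real t / (real n * real R))
      + 4 * (real t / real n) * ((4 * real R + 1) / real n * (real R ^ 2 / \<gamma>) ^ t)"
  proof -
    define s where "s = sqrt (2 * real t / (real n * real R))"
    define v where "v = (4 * real R + 1) / real n * (real R ^ 2 / \<gamma>) ^ t"
    have "4 * real n ^ (t + 1) * (real n * (2 * s * \<gamma> ^ t)) = h * (8 * s)"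
      unfolding h_def Gt[symmetric] by (simp add: power2_eq_square)
    moreover have "8 * real n * real G ^ t * (1 / 2 * real t * v) = h * (4 * (real t / real n) * v)"
      unfolding h_def using n by (simp add: power2_eq_square)
    ultimately have "4 * real n ^ (t + 1) * (real n * (2 * s * \<gamma> ^ t)) + 8 * real n * real G ^ t * (1 / 2 * real t * v)
      = h * (8 * s + 4 * (real t / real n) * v)" by (simp only: distrib_left)
    then show ?thesis unfolding s_def[symmetric] v_def[symmetric]
      using h0 by (metis nonzero_mult_div_cancel_left less_irrefl)
  qed
  also have "real R ^ 2 / \<gamma> = real R ^ 2 * real n / real (dip_mass n R)"
    by (simp add: \<gamma>_def G_def)
  finally show ?thesis using value_D by linarith
qed

section \<open>Choice of the radius and the final bound\<close>

theorem theorem1p6: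
  shows "\<exists>C::real. C > 0 \<and>
    (\<forall>n t :: nat. odd n \<and> t \<ge> 2 \<longrightarrow>
       sym_odd_cycle_value n t \<ge> 1 - C * (real t / (real n * sqrt (ln (real t)))))"
\<comment> \<open>The constant is 48 for differing cuts plus 16 for crossed cuts.\<close>
proof (intro exI[of _ 64] conjI allI impI)
  fix n t :: nat
  assume "odd n \<and> t \<ge> 2"
  then have n: "n > 0" and t: "t \<ge> 2" by (auto intro: odd_pos)
  define L where "L = ln (real t)"
  define \<tau> where "\<tau> = real t / (real n * sqrt L)"
  have "1 / 4 \<le> ln (2 :: real)" using ln_le_minus_one[of "1 / 2"] by (simp add: ln_div)
  also have "\<dots> \<le> L" using t by (simp add: L_def)
  finally have L: "L \<ge> 1 / 4" .
  have L_le: "L \<le> real t" using t ln_bound[of "real t"] by (simp add: L_def)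
  have "1 - 64 * \<tau> \<le> sym_odd_cycle_value n t"
  proof (cases "real n * L < 8 * real t")
    case True
    have "1 / 2 \<le> sqrt L" using L by (intro real_le_rsqrt) (simp add: power2_eq_square)
    also have "sqrt L = L / sqrt L" using L by (simp add: real_div_sqrt)
    also have "\<dots> \<le> (8 * real t / real n) / sqrt L"
      using True n L by (intro divide_right_mono) (auto simp: field_simps)
    finally have "1 - 64 * \<tau> \<le> 0" by (simp add: \<tau>_def)
    then show ?thesis using sym_odd_cycle_value_nonneg[of n t] by linarith
  next
    case False
    \<comment> \<open>The 8 keeps the growth factor \<open>exp (2 * x * t)\<close> of the variance
      below \<open>sqrt t\<close> and, with \<open>L \<le> t\<close>, gives
      \<open>8 * R \<le> n\<close>. As \<open>y \<ge> 1\<close>, rounding down loses at most a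
      factor 2.\<close>
    define y where "y = real n * L / (8 * real t)"
    define R where "R = nat \<lfloor>y\<rfloor>"
    have y1: "y \<ge> 1" using False t by (simp add: y_def field_simps)
    have "\<lfloor>y\<rfloor> \<ge> 1" using y1 by simp
    then have "real R = of_int \<lfloor>y\<rfloor>" "R \<ge> 1" unfolding R_def by linarith+
    then have R: "R \<ge> 1" "real R \<le> y" "y / 2 \<le> real R"
      using floor_correct[of y] by linarith+
    have "y \<le> real n * real t / (8 * real t)"
      unfolding y_def using L_le by (intro divide_right_mono mult_left_mono) auto
    then have "8 * real R \<le> real n" using R(2) t by simp
    then have R4: "4 * R \<le> n" by linarith
    have "2 * real t / (real n * real R) \<le> 2 * real t / (real n * (y / 2))"
      using R y1 n by (intro divide_left_mono mult_left_mono) auto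
    also have "\<dots> = 32 * (\<tau> ^ 2)"
      using L t n by (simp add: y_def \<tau>_def power_divide power_mult_distrib) (simp add: field_simps power2_eq_square)
    also have "\<dots> \<le> (6 * \<tau>)\<^sup>2" by (simp add: power_mult_distrib)
    finally have "sqrt (2 * real t / (real n * real R)) \<le> 6 * \<tau>"
      using L by (intro real_le_lsqrt) (auto simp: \<tau>_def)
    then have first: "8 * sqrt (2 * real t / (real n * real R)) \<le> 48 * \<tau>" by simp
    define x where "x = 2 * real R / real n"
    have x: "0 \<le> x" "x \<le> 1 / 2" using \<open>8 * real R \<le> real n\<close> n by (auto simp: x_def field_simps)
    have xL: "2 * x * real t \<le> L / 2" using R(2) n t by (simp add: x_def y_def field_simps)
    have mass: "real R ^ 2 * (real n - 2 * real R) \<le> real (dip_mass n R)"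
      using R4 by (intro dip_mass_ge) simp
    have mass_pos: "0 < real R ^ 2 * (real n - 2 * real R)"
      using R(1) n \<open>8 * real R \<le> real n\<close> by (intro mult_pos_pos) auto
    have "real R ^ 2 * real n / real (dip_mass n R) \<le> real R ^ 2 * real n / (real R ^ 2 * (real n - 2 * real R))"
      using mass_pos mass by (intro divide_left_mono[OF mass] mult_pos_pos[OF _ mass_pos]) auto
    also have "\<dots> = 1 / (1 - x)" using R n x by (simp add: x_def field_simps)
    also have "\<dots> \<le> exp (2 * x)"
    proof -
      have "x * x \<le> (1 / 2) * x" using x by (intro mult_right_mono)
      then have "1 \<le> (1 - x) * (1 + 2 * x)" by (simp add: algebra_simps)
      also have "\<dots> \<le> (1 - x) * exp (2 * x)" using x exp_ge_add_one_self[of "2 * x"] by (intro mult_left_mono) auto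
      finally show ?thesis using x by (simp add: field_simps)
    qed
    finally have "(real R ^ 2 * real n / real (dip_mass n R)) ^ t \<le> exp (2 * x) ^ t"
      by (intro power_mono) auto
    also have "\<dots> = exp (2 * x * real t)" by (simp add: exp_of_nat_mult[symmetric] mult.commute)
    also have "\<dots> \<le> exp (L / 2)" using xL by simp
    also have "\<dots> = sqrt (real t)" using t by (simp add: L_def ln_sqrt[symmetric])
    finally have tilt: "(real R ^ 2 * real n / real (dip_mass n R)) ^ t \<le> sqrt (real t)" .
    have "(4 * real R + 1) / real n \<le> 5 * y / real n" using R by (intro divide_right_mono) auto
    also have "\<dots> = 5 * L / (8 * real t)" using n by (simp add: y_def)
    finally have "4 * (real t / real n) * ((4 * real R + 1) / real n * (real R ^ 2 * real n / real (dip_mass n R)) ^ t)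
      \<le> 4 * (real t / real n) * (5 * L / (8 * real t) * sqrt (real t))"
      using tilt L by (intro mult_left_mono mult_mono) auto
    also have "\<dots> \<le> 16 * \<tau>"
    proof -
      \<comment> \<open>The crossing term is \<open>5 / 2 * L * sqrt t / n\<close>, so comparison
        with \<open>\<tau>\<close> requires \<open>L * sqrt L\<close> to be of order
        \<open>sqrt t\<close>; cubing this inequality gives it.\<close>
      have "L / 3 \<le> exp (L / 3)" using exp_ge_add_one_self[of "L / 3"] by linarith
      then have "(L / 3) ^ 3 \<le> exp (L / 3) ^ 3" using L by (intro power_mono) auto
      also have "\<dots> = real t" using t by (simp add: L_def exp_of_nat_mult[symmetric])
      finally have "L ^ 3 \<le> 27 * real t" by (simp add: power_divide)
      also have "\<dots> \<le> 36 * real t" by simp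
      finally have "sqrt (L ^ 3) \<le> sqrt (36 * real t)" by simp
      then have "L * sqrt L \<le> 6 * sqrt (real t)" using L
        by (simp add: real_sqrt_mult power3_eq_cube)
      then have "L * sqrt L * sqrt (real t) \<le> 6 * sqrt (real t) * sqrt (real t)"
        by (intro mult_right_mono) auto
      also have "\<dots> = 6 * real t" by simp
      finally have "L * sqrt (real t) * sqrt L \<le> 6 * real t" by (simp add: mult.commute mult.left_commute)
      then have "5 / 2 * (L * sqrt (real t)) / real n \<le> 16 * \<tau>"
        using n L t by (simp add: \<tau>_def field_simps)
      then show ?thesis using t by simp
    qed
    finally show ?thesis
      using first sym_odd_cycle_value_lower_bound[of R n t] R R4 by linarith
  qed
  then show "sym_odd_cycle_value n t \<ge> 1 - 64 * (real t / (real n * sqrt (ln (real t))))"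
    by (simp add: \<tau>_def L_def)
qed simp

end
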